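(* Let $L\geqslant 2$, let $\theta$ be the Vandermonde (spin) substitution of length $L$ on $\mathcal{A}=\mathcal{D}\times G$, where $\mathcal{D}=\{0,\dots,L-1\}$ and $G$ is the group of $L$-th roots of unity, let $v\in\mathcal{A}^{\mathbb{N}}$ be a fixed point of $\theta$ and let $w=\pi_G(v)\in G^{\mathbb{N}}$ be its spin coding. Then there exist an increasing sequence $\{d_n\}\subset\mathbb{N}$ and a real number $\alpha$ with $0<\alpha\leqslant 1$ such that $A_w(d_n)\gtrsim d_n^{\alpha}/L$.
   Context: Vandermonde substitution: let $\omega=e^{-2\pi \mathrm{i}/L}$, $G=\{1,\omega,\dots,\omega^{L-1}\}$, $\mathcal{D}=\{0,1,\dots,L-1\}$, $\mathcal{A}=\mathcal{D}\times G$, with coordinate projections $\pi_{\mathcal{D}}\colon\mathcal{A}\to\mathcal{D}$ and $\pi_G\colon\mathcal{A}\to G$ (the latter is applied letterwise to infinite words). The spin matrix is the Vandermonde (DFT) matrix $V(i,j)=\omega^{ij}$, $0\leqslant i,j\leqslant L-1$. The substitution $\theta\colon\mathcal{A}\to\mathcal{A}^L$ is defined by $\theta(a)=a_0a_1\cdots a_{L-1}$ where $\pi_{\mathcal{D}}(a_i)=i$ and $\pi_G(a_i)=V(i,\pi_{\mathcal{D}}(a))\,\pi_G(a)$; it is extended to infinite words by concatenation, and a fixed point is $v\in\mathcal{A}^{\mathbb{N}}$ with $\theta(v)=v$. For an infinite word $w=w_0w_1\cdots$ and $d\geqslant1$, $A_w(d)$ is the maximum (supremum, in $\mathbb{N}\cup\{\infty\}$)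 of all $M$ such that there is a start $k\in\mathbb{N}$ with $w_k=w_{k+dn}$ for all $0\leqslant n\leqslant M-1$ (a monochromatic arithmetic progression of difference $d$ and length $M$). For $f,g\colon\mathbb{N}\to\mathbb{R}_{>0}$: $f(n)\sim g(n)$ means $\lim_{n\to\infty}f(n)/g(n)=1$, and $f(n)\gtrsim g(n)$ means there is $h\colon\mathbb{N}\to\mathbb{R}_{>0}$ with $f(n)\geqslant h(n)$ for all $n$ and $h(n)\sim g(n)$. Here $f(n)=A_w(d_n)$ and $g(n)=d_n^\alpha/L$. $\mathbb{N}=\mathbb{Z}_{\geqslant0}$. *)

theory Defs
  imports Complex_Main "HOL-Library.Extended_Nat" "HOL-Library.Landau_Symbols"
begin

text \<open>
  Letters are pairs of a digit and a spin, with projections \<^const>\<open>fst\<close> and \<^const>\<open>snd\<close>.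
  Infinite words are functions on \<^typ>\<open>nat\<close>.
\<close>

type_synonym letter = "nat \<times> complex"

definition omega :: "nat \<Rightarrow> complex" where
  "omega L = exp (- 2 * of_real pi * \<i> / of_nat L)"

definition spin_group :: "nat \<Rightarrow> complex set" where
  "spin_group L = {omega L ^ k | k. k < L}"

definition alphabet :: "nat \<Rightarrow> letter set" where
  "alphabet L = {..<L} \<times> spin_group L"

definition vandermonde :: "nat \<Rightarrow> nat \<Rightarrow> nat \<Rightarrow> complex" where
  "vandermonde L i j = omega L ^ (i * j)"

definition theta :: "nat \<Rightarrow> letter \<Rightarrow> letter list" where
  "theta L a = map (\<lambda>i. (i, vandermonde L i (fst a) * snd a)) [0..<L]"

text \<open>
  Every \<^term>\<open>theta L a\<close> has length \<^term>\<open>L\<close>, so position \<^term>\<open>m\<close> of the concatenation of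
  \<^term>\<open>theta L (v 0)\<close>, \<^term>\<open>theta L (v 1)\<close>, ... lies in block \<^term>\<open>m div L\<close>
  at offset \<^term>\<open>m mod L\<close>.
\<close>

definition theta_word :: "nat \<Rightarrow> (nat \<Rightarrow> letter) \<Rightarrow> (nat \<Rightarrow> letter)" where
  "theta_word L v = (\<lambda>m. theta L (v (m div L)) ! (m mod L))"

definition theta_fixed_point :: "nat \<Rightarrow> (nat \<Rightarrow> letter) \<Rightarrow> bool" where
  "theta_fixed_point L v \<longleftrightarrow> range v \<subseteq> alphabet L \<and> theta_word L v = v"

definition spin_coding :: "(nat \<Rightarrow> letter) \<Rightarrow> (nat \<Rightarrow> complex)" where
  "spin_coding v = snd \<circ> v"

definition max_AP :: "(nat \<Rightarrow> 'a) \<Rightarrow> nat \<Rightarrow> enat" where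
  "max_AP w d = Sup {enat M | M. \<exists>k. \<forall>n<M. w k = w (k + d * n)}"

text \<open>
  Only meant for positive \<^term>\<open>f\<close> and \<^term>\<open>g\<close>; there \<^const>\<open>asymp_equiv\<close> says exactly that
  the quotient tends to 1.
\<close>

definition asymp_ge :: "(nat \<Rightarrow> real) \<Rightarrow> (nat \<Rightarrow> real) \<Rightarrow> bool" where
  "asymp_ge f g \<longleftrightarrow> (\<exists>h. (\<forall>n. 0 < h n \<and> h n \<le> f n) \<and> h \<sim>[at_top] g)"

end

theory Submission
  imports Defs "HOL-Number_Theory.Cong"
begin

text \<open>
  Up to the constant factor \<open>w 0\<close>, the spin at position \<open>m\<close> is \<open>\<omega>\<close> raised to the sum \<open>S m\<close> of
  the products of adjacent base-\<open>L\<close> digits of \<open>m\<close>. Multiplying \<open>m < L\<^sup>n\<close> by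
  \<open>d = \<Sum>j<L. L\<^bsup>(n+1)j\<^esup>\<close> writes \<open>L\<close> copies of \<open>m\<close> separated by zeros, so \<open>S (d m) = L S m\<close> and the
  progression \<open>0, d, 2d, \<dots>\<close> is monochromatic for \<open>L\<^sup>n\<close> steps, while \<open>d \<le> L\<^bsup>L(n+1)\<^esup>\<close>. This gives
  the exponent \<open>\<alpha> = 1/L\<close>.

  Finiteness: some \<open>c\<close> satisfies \<open>w c \<noteq> w (c + d)\<close>, because appending a leading digit 1 to \<open>c\<close> and
  \<open>c + d\<close> with different top digits shifts the two spins by different amounts. As \<open>d\<close> is coprime
  to \<open>L\<close>, every long progression of difference \<open>d\<close> meets the class of \<open>c\<close> modulo a large power
  of \<open>L\<close>, and there the higher digits contribute the same factor to both spins.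
\<close>

section \<open>Sums of products of adjacent digits\<close>

function digit_corr :: "nat \<Rightarrow> nat \<Rightarrow> nat" where
  "digit_corr L m =
     (if L < 2 \<or> m = 0 then 0 else (m mod L) * (m div L mod L) + digit_corr L (m div L))"
  by auto
termination
  by (relation "measure snd") (auto intro: div_less_dividend)

declare digit_corr.simps [simp del]

lemma digit_corr_0 [simp]: "digit_corr L 0 = 0"
  by (simp add: digit_corr.simps)

lemma digit_corr_rec:
  assumes "L \<ge> 2"
  shows "digit_corr L m = (m mod L) * (m div L mod L) + digit_corr L (m div L)"
  using assms by (subst digit_corr.simps) auto

lemma digit_corr_less:
  assumes "L \<ge> 2" "m < L"
  shows "digit_corr L m = 0"
  using assms by (subst digit_corr_rec) auto

text \<open>Only the junction creates a new product: the lowest digit of \<open>b\<close> meets the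
  digit of \<open>c\<close> at position \<open>t\<close>, which may be 0. Peeling off the lowest
  digit of \<open>c\<close> leaves the junction intact, hence the induction on
  \<open>t\<close>.\<close>

lemma digit_corr_append:
  assumes L: "L \<ge> 2" and "c < L ^ Suc t"
  shows "digit_corr L (b * L ^ Suc t + c)
           = digit_corr L b + digit_corr L c + (b mod L) * (c div L ^ t)"
  using assms(2)
proof (induction t arbitrary: c)
  case 0
  then show ?case
    using L digit_corr_rec[of L "b * L + c"] digit_corr_less[of L c] by simp
next
  case (Suc t)
  define e where "e = c div L"
  have e: "e < L ^ Suc t"
    using Suc.prems L by (simp add: e_def less_mult_imp_div_less mult.commute)
  have split: "b * L ^ Suc (Suc t) + c = L * (b * L ^ Suc t) + c"
    by simp
  have div: "(b * L ^ Suc (Suc t) + c) div L = b * L ^ Suc t + e"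
    unfolding split e_def using L by (subst div_mult_self4) auto
  have mod: "(b * L ^ Suc (Suc t) + c) mod L = c mod L"
    unfolding split by simp
  have "b * L ^ Suc t + e = (b * L ^ t) * L + e"
    by simp
  then have "(b * L ^ Suc t + e) mod L = e mod L"
    by (metis mod_mult_self3)
  then have "digit_corr L (b * L ^ Suc (Suc t) + c)
      = (c mod L) * (e mod L) + digit_corr L (b * L ^ Suc t + e)"
    using digit_corr_rec[OF L, of "b * L ^ Suc (Suc t) + c"] div mod by simp
  also have "\<dots> = (c mod L) * (e mod L) + digit_corr L b + digit_corr L e
      + (b mod L) * (e div L ^ t)"
    using Suc.IH[OF e] by simp
  also have "\<dots> = digit_corr L b + digit_corr L c + (b mod L) * (c div L ^ Suc t)"
    using digit_corr_rec[OF L, of c] by (simp add: e_def div_mult2_eq)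
  finally show ?case .
qed

lemma digit_corr_append_zero:
  assumes "L \<ge> 2" "c < L ^ t"
  shows "digit_corr L (b * L ^ Suc t + c) = digit_corr L b + digit_corr L c"
proof -
  have "L ^ t \<le> L ^ Suc t"
    using assms by (intro power_increasing) auto
  then have "c < L ^ Suc t"
    using assms by linarith
  then show ?thesis
    using assms by (simp only: digit_corr_append) simp
qed

text \<open>As \<open>m\<close> has at most \<open>n\<close> digits, a shift by \<open>Suc n\<close>
  places leaves a zero between consecutive copies of \<open>m\<close>, so the copies contribute
  independently.\<close>

lemma digit_corr_repeat:
  assumes "L \<ge> 2" "m < L ^ n"
  shows "digit_corr L ((\<Sum>j<J. (L ^ Suc n) ^ j) * m) = J * digit_corr L m"
proof (induction J)
  case (Suc J)
  have "(\<Sum>j<Suc J. (L ^ Suc n) ^ j) = 1 + L ^ Suc n * (\<Sum>j<J. (L ^ Suc n) ^ j)"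
    by (subst sum.lessThan_Suc_shift) (simp add: sum_distrib_left)
  then have "(\<Sum>j<Suc J. (L ^ Suc n) ^ j) * m
      = ((\<Sum>j<J. (L ^ Suc n) ^ j) * m) * L ^ Suc n + m"
    by (simp add: algebra_simps)
  then show ?case
    using digit_corr_append_zero[OF assms] Suc.IH by simp
qed simp

section \<open>The root of unity\<close>

lemma omega_power_self:
  assumes "L > 0"
  shows "omega L ^ L = 1"
proof -
  have "omega L ^ L = exp (of_nat L * (- 2 * of_real pi * \<i> / of_nat L))"
    by (simp only: omega_def exp_of_nat_mult)
  also have "of_nat L * (- 2 * of_real pi * \<i> / of_nat L) = - (2 * of_real pi * \<i>)"
    using assms by simp
  also have "exp \<dots> = 1"
    by (simp only: exp_minus exp_two_pi_i inverse_1)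
  finally show ?thesis .
qed

lemma omega_neq_0: "omega L \<noteq> 0"
  by (simp add: omega_def)

lemma omega_neq_1:
  assumes "L \<ge> 2"
  shows "omega L \<noteq> 1"
proof
  assume "omega L = 1"
  then have "exp (\<i> * of_real (- 2 * pi / real L)) = 1"
    by (simp add: omega_def mult_ac)
  then have "cis (- 2 * pi / real L) = 1"
    by (simp only: cis_conv_exp)
  then have "cos (2 * pi / real L) = 1"
    by (simp add: complex_eq_iff)
  then obtain k :: int where "2 * pi / real L = real_of_int k * 2 * pi"
    using cos_one_2pi_int by blast
  then have k: "real_of_int k * real L = 1"
    using assms by (simp add: field_simps)
  then have "k * int L = 1"
    by (metis of_int_1 of_int_eq_iff of_int_mult of_int_of_nat_eq)
  then have "int L dvd 1"
    by (metis dvd_triv_right)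
  then show False
    using assms by simp
qed

section \<open>Spins of a fixed point\<close>

lemma theta_word_nth:
  assumes "L > 0"
  shows "theta_word L v m = (m mod L, omega L ^ (m mod L * fst (v (m div L))) * snd (v (m div L)))"
  using assms by (simp add: theta_word_def theta_def vandermonde_def)

lemma spin_coding_eq:
  assumes L: "L \<ge> 2" and v: "theta_fixed_point L v"
  shows "spin_coding v m = spin_coding v 0 * omega L ^ digit_corr L m"
proof (induction m rule: less_induct)
  case (less m)
  have nth: "v m = (m mod L, omega L ^ (m mod L * fst (v (m div L))) * snd (v (m div L)))" for m
    using v L theta_word_nth[of L v m] by (simp add: theta_fixed_point_def)
  show ?case
  proof (cases "m = 0")
    case False
    then have "m div L < m"
      using L by simp
    then have IH: "spin_coding v (m div L) = spin_coding v 0 * omega L ^ digit_corr L (m div L)"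
      by (rule less.IH)
    \<comment> \<open>The first component of a letter of \<open>v\<close> is its offset in its
      block, that is, the last digit of its position; here this is the second-lowest digit of
      \<open>m\<close>.\<close>
    have "fst (v (m div L)) = m div L mod L"
      by (subst nth) simp
    then have "spin_coding v m
        = omega L ^ (m mod L * (m div L mod L)) * spin_coding v (m div L)"
      unfolding spin_coding_def comp_def by (subst nth) simp
    then show ?thesis
      unfolding IH digit_corr_rec[OF L, of m] by (simp only: power_add mult_ac)
  qed simp
qed

lemma spin_coding_neq_0:
  assumes "theta_fixed_point L v"
  shows "spin_coding v m \<noteq> 0"
proof -
  have "v m \<in> alphabet L"
    using assms by (auto simp: theta_fixed_point_def)
  then show ?thesis
    by (auto simp: alphabet_def spin_group_def spin_coding_def omega_neq_0)
qed

section \<open>Finiteness of monochromatic progressions\<close>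

lemma le_max_AP:
  assumes "\<And>n. n < M \<Longrightarrow> w k = w (k + d * n)"
  shows "enat M \<le> max_AP w d"
  unfolding max_AP_def using assms by (intro Sup_upper) blast

lemma max_AP_le:
  assumes "\<And>k. \<exists>n\<le>Q. w k \<noteq> w (k + d * n)"
  shows "max_AP w d \<le> enat Q"
  unfolding max_AP_def
proof (rule Sup_least, clarify)
  fix M k
  assume mono: "\<forall>n<M. w k = w (k + d * n)"
  obtain n where "n \<le> Q" "w k \<noteq> w (k + d * n)"
    using assms by blast
  then have "M \<le> Q"
    using mono by (meson le_trans not_le_imp_less)
  then show "enat M \<le> enat Q"
    by simp
qed

lemma AP_meets_residue_class:
  fixes d Q k c :: nat
  assumes "coprime d Q" "Q > 0"
  obtains n where "n < Q" "[k + d * n = c] (mod Q)"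
proof -
  obtain x where x: "[d * x = 1] (mod Q)"
    using cong_solve_coprime_nat[OF assms(1)] by auto
  \<comment> \<open>\<open>x\<close> inverts \<open>d\<close> modulo \<open>Q\<close>, and
    \<open>(Q - 1) * k\<close> represents \<open>- k\<close> within the naturals.\<close>
  define n where "n = (x * (c + (Q - 1) * k)) mod Q"
  have "[d * n = d * x * (c + (Q - 1) * k)] (mod Q)"
    unfolding n_def cong_def by (simp add: mod_mult_right_eq mult.assoc)
  also have "[d * x * (c + (Q - 1) * k) = 1 * (c + (Q - 1) * k)] (mod Q)"
    using x by (rule cong_mult) simp
  finally have "[k + d * n = k + 1 * (c + (Q - 1) * k)] (mod Q)"
    by (intro cong_add) auto
  moreover have "k + 1 * (c + (Q - 1) * k) = c + Q * k"
    using assms(2) by (cases Q) auto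
  ultimately have "[k + d * n = c] (mod Q)"
    by (simp only: cong_def mod_mult_self2)
  moreover have "n < Q"
    using assms(2) by (simp add: n_def)
  ultimately show thesis
    using that by blast
qed

lemma spin_coding_not_periodic:
  assumes L: "L \<ge> 2" and v: "theta_fixed_point L v" and d: "d > 0"
  obtains c where "spin_coding v c \<noteq> spin_coding v (c + d)"
proof -
  let ?S = "digit_corr L"
  have eq_iff: "spin_coding v a = spin_coding v b \<longleftrightarrow> omega L ^ ?S a = omega L ^ ?S b" for a b
    using spin_coding_neq_0[OF v, of 0]
      spin_coding_eq[OF L v, of a] spin_coding_eq[OF L v, of b] by simp
  \<comment> \<open>All \<open>d\<close> digits of \<open>c\<close> are \<open>L - 1\<close>, so
    adding \<open>d\<close> carries: the digit at position \<open>d\<close> is 0 for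
    \<open>c\<close> and 1 for \<open>c + d\<close>.\<close>
  define c where "c = L ^ d - 1"
  \<comment> \<open>The new leading 1 sits directly above position \<open>d\<close>, so it adds 0 to
    the exponent at \<open>c\<close> and 1 at \<open>c + d\<close>. Equal spins in both pairs would
    force \<omega> = 1.\<close>
  define c' where "c' = 1 * L ^ Suc d + c"
  have "d < L ^ d"
    using L by (intro power_gt_expt) auto
  moreover have "2 * L ^ d \<le> L ^ Suc d"
    using L by simp
  ultimately have c: "c < L ^ d" "c + d < L ^ Suc d" "c + d = L ^ d + (d - 1)" "d - 1 < L ^ d"
    using d unfolding c_def by linarith+
  have top: "c div L ^ d = 0" "(c + d) div L ^ d = 1"
    unfolding c(3) using c(1,4) L by (simp_all add: div_add_self1)
  have S1: "?S 1 = 0" "1 mod L = 1"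
    using L digit_corr_less[OF L, of 1] by auto
  have "?S c' = ?S c"
    unfolding c'_def using c(2) top S1 by (subst digit_corr_append[OF L]) auto
  moreover have "?S (c' + d) = Suc (?S (c + d))"
    unfolding c'_def add.assoc using c(2) top S1 by (subst digit_corr_append[OF L]) auto
  moreover have "omega L ^ Suc (?S (c + d)) \<noteq> omega L ^ ?S (c + d)"
    using omega_neq_1[OF L] omega_neq_0[of L] by simp
  ultimately have "spin_coding v c \<noteq> spin_coding v (c + d) \<or> spin_coding v c' \<noteq> spin_coding v (c' + d)"
    unfolding eq_iff by metis
  then show thesis
    using that by blast
qed

lemma max_AP_spin_coding_finite:
  assumes L: "L \<ge> 2" and v: "theta_fixed_point L v" and d: "d > 0" "coprime d L"
  shows "max_AP (spin_coding v) d \<noteq> \<infinity>"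
proof -
  let ?w = "spin_coding v"
  obtain c where c: "?w c \<noteq> ?w (c + d)"
    using spin_coding_not_periodic[OF L v d(1)] .
  \<comment> \<open>Since \<open>t < L ^ t\<close>, digit \<open>t\<close> of both \<open>c\<close>
    and \<open>c + d\<close> is 0, so digits \<open>y\<close> placed above it multiply both spins by
    the same factor.\<close>
  define t where "t = c + d"
  define Q where "Q = L ^ Suc t"
  have small: "c + d < L ^ t" "c < L ^ t"
    using power_gt_expt[of L t] L by (auto simp: t_def)
  have Q: "Q > 0" "coprime d Q"
    using L d(2) by (auto simp: Q_def simp del: power_Suc)
  have "L ^ t \<le> Q"
    unfolding Q_def using L by (intro power_increasing) auto
  then have "c < Q"
    using small(2) by simp
  have "\<exists>n\<le>Q. ?w k \<noteq> ?w (k + d * n)" for k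
  proof -
    obtain n where n: "n < Q" "[k + d * n = c] (mod Q)"
      using AP_meets_residue_class[OF Q(2,1)] .
    define y where "y = (k + d * n) div Q"
    have "(k + d * n) mod Q = c"
      using n(2) \<open>c < Q\<close> by (simp add: cong_def)
    then have x: "k + d * n = y * L ^ Suc t + c"
      unfolding y_def Q_def[symmetric] by (metis div_mult_mod_eq)
    have "?w (k + d * n) = ?w c * omega L ^ digit_corr L y"
      using spin_coding_eq[OF L v, of "k + d * n"] spin_coding_eq[OF L v, of c]
        digit_corr_append_zero[OF L small(2), of y]
      by (simp only: x power_add mult_ac)
    moreover have "k + d * Suc n = y * L ^ Suc t + (c + d)"
      using x by simp
    then have "?w (k + d * Suc n) = ?w (c + d) * omega L ^ digit_corr L y"
      using spin_coding_eq[OF L v, of "k + d * Suc n"] spin_coding_eq[OF L v, of "c + d"]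
        digit_corr_append_zero[OF L small(1), of y]
      by (simp only: power_add mult_ac)
    ultimately have "?w (k + d * n) \<noteq> ?w (k + d * Suc n)"
      using c omega_neq_0 by simp
    \<comment> \<open>Two unequal spins cannot both equal the first spin of the progression.\<close>
    then have "?w k \<noteq> ?w (k + d * n) \<or> ?w k \<noteq> ?w (k + d * Suc n)"
      by metis
    moreover have "n \<le> Q" "Suc n \<le> Q"
      using n(1) by auto
    ultimately show ?thesis
      by blast
  qed
  then have "max_AP ?w d \<le> enat Q"
    by (rule max_AP_le)
  then show ?thesis
    by (cases "max_AP ?w d") auto
qed

section \<open>Differences with long progressions\<close>

lemma geometric_sum_le_power:
  fixes x :: nat
  assumes "x \<ge> 2"
  shows "(\<Sum>j<J. x ^ j) \<le> x ^ J"
proof (induction J)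
  case (Suc J)
  have "(\<Sum>j<Suc J. x ^ j) \<le> 2 * x ^ J"
    using Suc by simp
  also have "\<dots> \<le> x ^ Suc J"
    using assms by simp
  finally show ?case .
qed simp

theorem theorem2:
  fixes L :: nat and v :: "nat \<Rightarrow> letter" and w :: "nat \<Rightarrow> complex"
  assumes "L \<ge> 2"
    and "theta_fixed_point L v"
    and "w = spin_coding v"
  shows "\<exists>(d :: nat \<Rightarrow> nat) (\<alpha> :: real).
           strict_mono d \<and> (\<forall>n. d n \<ge> 1) \<and> 0 < \<alpha> \<and> \<alpha> \<le> 1 \<and>
           (\<forall>n. max_AP w (d n) \<noteq> \<infinity>) \<and>
           asymp_ge (\<lambda>n. real (the_enat (max_AP w (d n)))) (\<lambda>n. real (d n) powr \<alpha> / real L)"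
proof -
  note L = assms(1) and v = assms(2) and w = assms(3)
  \<comment> \<open>Taking exactly \<open>L\<close> copies makes every exponent of \<omega> along
    the progression from 0 a multiple of \<open>L\<close>.\<close>
  define d where "d n = (\<Sum>j<L. (L ^ Suc n) ^ j)" for n
  \<comment> \<open>Splitting off the term \<open>j = 0\<close> exhibits \<open>d n\<close> as 1
    modulo \<open>L\<close>, which yields coprimality.\<close>
  have d_eq: "d n = 1 + L ^ Suc n * (\<Sum>j<L - 1. (L ^ Suc n) ^ j)" for n
  proof -
    have "d n = (\<Sum>j<Suc (L - 1). (L ^ Suc n) ^ j)"
      using L by (simp add: d_def)
    then show ?thesis
      by (simp only: sum.lessThan_Suc_shift) (simp add: sum_distrib_left)
  qed
  have pos: "d n > 0" for n
    by (simp add: d_eq)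
  have "strict_mono d"
    unfolding strict_mono_Suc_iff
  proof
    fix n
    \<comment> \<open>No term decreases with \<open>n\<close>, and the term \<open>j = 1\<close>,
      present because \<open>L \<ge> 2\<close>, strictly increases.\<close>
    have "(L ^ Suc n) ^ j \<le> (L ^ Suc (Suc n)) ^ j" for j
      using L by (intro power_mono power_increasing) auto
    moreover have "(L ^ Suc n) ^ 1 < (L ^ Suc (Suc n)) ^ 1"
      unfolding power_one_right using L by (intro power_strict_increasing) auto
    ultimately show "d n < d (Suc n)"
      unfolding d_def using L by (intro sum_strict_mono_ex1 bexI[of _ 1]) auto
  qed
  have "coprime (d n) L" for n
  proof -
    have "d n = 1 + L * (L ^ n * (\<Sum>j<L - 1. (L ^ Suc n) ^ j))"
      by (simp add: d_eq mult.assoc)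
    then have "[d n = 1] (mod L)"
      by (simp only: cong_def mod_mult_self2)
    then show ?thesis
      by (metis cong_imp_coprime cong_sym coprime_1_left)
  qed
  then have fin: "max_AP w (d n) \<noteq> \<infinity>" for n
    unfolding w using L v pos by (intro max_AP_spin_coding_finite) auto
  have long: "enat (L ^ n) \<le> max_AP w (d n)" for n
  proof (rule le_max_AP[where k = 0])
    fix m
    assume "m < L ^ n"
    then have "digit_corr L (d n * m) = L * digit_corr L m"
      unfolding d_def by (rule digit_corr_repeat[OF L])
    then show "w 0 = w (0 + d n * m)"
      using spin_coding_eq[OF L v, of "d n * m"] omega_power_self[of L] L
      by (simp add: w power_mult)
  qed
  have bound: "real (d n) powr (1 / real L) / real L \<le> real (the_enat (max_AP w (d n)))" for n
  proof -
    have "L ^ 1 \<le> L ^ Suc n"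
      using L by (intro power_increasing) auto
    then have "L ^ Suc n \<ge> 2"
      using L unfolding power_one_right by linarith
    then have "d n \<le> (L ^ Suc n) ^ L"
      unfolding d_def by (rule geometric_sum_le_power)
    then have "real (d n) \<le> real (L ^ Suc n) ^ L"
      by (metis of_nat_le_iff of_nat_power)
    also have "\<dots> = real (L ^ Suc n) powr real L"
      using L by (simp add: powr_realpow del: power_Suc)
    finally have "real (d n) powr (1 / real L) \<le> (real (L ^ Suc n) powr real L) powr (1 / real L)"
      by (intro powr_mono2) auto
    also have "\<dots> = real (L ^ Suc n)"
      using L by (simp add: powr_powr del: power_Suc)
    \<comment> \<open>The division by \<open>L\<close> absorbs the separating zero:
      \<open>L ^ Suc n / L = L ^ n\<close>.\<close>
    finally have "real (d n) powr (1 / real L) / real L \<le> real (L ^ n)"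
      using L by (simp add: field_simps)
    also have "\<dots> \<le> real (the_enat (max_AP w (d n)))"
      using long[of n] fin[of n] by (cases "max_AP w (d n)") auto
    finally show ?thesis .
  qed
  \<comment> \<open>The bound holds for every \<open>n\<close>, so the comparison function can be
    the right-hand side itself.\<close>
  have "asymp_ge (\<lambda>n. real (the_enat (max_AP w (d n)))) (\<lambda>n. real (d n) powr (1 / real L) / real L)"
    unfolding asymp_ge_def
    using bound pos L by (intro exI[of _ "\<lambda>n. real (d n) powr (1 / real L) / real L"]) auto
  moreover have "d n \<ge> 1" for n
    using pos[of n] by simp
  ultimately show ?thesis
    using \<open>strict_mono d\<close> fin L
    by (intro exI[of _ d] exI[of _ "1 / real L"]) auto
qed

end
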